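(* Let $\mathsf n\ge 1$ and $\mathsf m\ge 1$ be integers, $\rho\in(0,1)$, $\mathsf P_l\in[0,1)$. Consider $\mathsf n$ nodes operating under irregular repetition slotted ALOHA (IRSA) with frames of $\mathsf m$ slots, per-slot activation probability $\rho$, packet loss rate $\mathsf P_l$ and aggregate throughput $\mathsf S=\frac{\mathsf n[1-(1-\rho)^{\mathsf m}]}{\mathsf m}(1-\mathsf P_l)$. For a given node with current age of information $\delta(t)$, let $\delta_k'=\delta(k\mathsf m)+\mathsf m$ be the age at the end of frame $k$ just before a possible refresh, and for an integer threshold $\theta$ let the age-violation probability be $$\zeta(\theta):=\lim_{k\to\infty}\mathbb P\{\delta_k'>\theta\}=\mathbb P\{\Omega>\theta-2\mathsf m-1\},$$ where $\Omega$ is a random variable distributed according to the stationary distribution of $\Omega_k=\delta(k\mathsf m)-(\mathsf m+1)$. Then $$\zeta(\theta)=\begin{cases}\dfrac{\mathsf m\mathsf S}{\mathsf n}\left(1-\dfrac{\mathsf m\mathsf S}{\mathsf n}\right)^{\beta_{\theta-2\mathsf m}}\cdot\dfrac{(1-\rho)^{1+\alpha_{\theta-2\mathsf m}}-(1-\rho)^{\mathsf m}}{1-(1-\rho)^{\mathsf m}}+\left(1-\dfrac{\mathsf m\mathsf S}{\mathsf n}\right)^{1+\beta_{\theta-2\mathsf m}} & \theta>2\mathsf m\\[2ex] 1&\text{otherwise,}\end{cases}$$ where, for $x\in\mathbb N_0$, $\alpha_x=x\bmod \mathsf m$ and $\beta_x=\lfloor x/\mathsf m\rfloor$.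
   Context: Time is measured in slots of unit duration. There are $\mathsf n$ nodes sharing a channel to a common sink. At each slot every node independently becomes active with probability $\rho$ and generates an update time-stamped with the start of that slot. Under IRSA, time is divided into frames of $\mathsf m$ slots. A node that became active at least once during a frame transmits, over the next frame, only its most recently generated update (as several replicas in randomly chosen slots of the frame, decoded at the sink at the end of the frame by successive interference cancellation). There are no retransmissions. A transmitted update is decoded with probability $1-\mathsf P_l$, where $\mathsf P_l$ is the packet loss rate. The channel load is $\mathsf G=\mathsf n[1-(1-\rho)^{\mathsf m}]/\mathsf m$ and the aggregate throughput (average number of decoded packets per slot) is $\mathsf S=\mathsf G(1-\mathsf P_l)$. The current age of information of a node is $\delta(t)=t-\sigma(t)$, where $\sigma(t)$ is the time-stamp of the last update received from that node by time $t$. It grows linearly with slope 1 inside each frame $[k\mathsf m,(k+1)\mathsf m)$. At the end of each frame, independently over frames, an update of the node is delivered with probability $\xi:=[1-(1-\rho)^{\mathsf m}](1-\mathsf P_l)=\mathsf m\mathsf S/\mathsf n$. If it is delivered, the age is reset to $\mathsf m+B$, where $B\in\{1,\dots,\mathsf m\}$ is the number of slots between the generation of the update and the start of the frame in which it is sent, with probability mass function $$p_B(b)=\frac{\rho(1-\rho)^{b-1}}{1-(1-\rho)^{\mathsf m}}.$$ If it is not delivered, the age is not reset. Time $t=0$ is set right after the reception of the first update, so $\delta(0)\in\{\mathsf m+1,\dots,2\mathsf m\}$. Accordingly, $\Omega_k:=\delta(k\mathsf m)-(\mathsf m+1)$, $k\in\mathbb N_0$, is an ergodic Markov chain on $\mathbb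 N_0$ with one-step transition probabilities, for every state $i\in\mathbb N_0$: $q_{(i,j)}=\xi\,p_B(j+1)$ if $j\in\{0,\dots,\mathsf m-1\}$, $q_{(i,j)}=1-\xi$ if $j=i+\mathsf m$, and $q_{(i,j)}=0$ otherwise.
   Formalization: For θ>2m the subscripts θ−2m of α and β are replaced by θ−2m−1; as printed the formula gives P{Ω>θ−2m}, not P{Ω>θ−2m−1} (for m=1, θ=3 it gives (1−ξ)² instead of 1−ξ, with ξ=mS/n). *)

theory Defs
  imports "HOL-Probability.Probability"
begin

text \<open>
  Slot \<open>s :: int\<close> is the time interval \<open>[s, s + 1)\<close>, and an update generated in it has time-stamp \<open>s\<close>.
  Frame \<open>k :: nat\<close> is \<open>[k m, (k + 1) m)\<close>; the updates sent over it were generated in the \<open>m\<close> slots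
  preceding it. Slots with a negative index are needed because what is sent over frame 0 was
  generated before time 0.
\<close>

definition generation_slots :: "nat \<Rightarrow> nat \<Rightarrow> int set" where
  "generation_slots m k = {int k * int m - int m ..< int k * int m}"

text \<open>
  Below, \<open>a s \<omega>\<close> says that the node is active in slot \<open>s\<close>, and \<open>d k \<omega>\<close> that an update it sends over
  frame \<open>k\<close> is decoded at the end of that frame. When nothing is sent over frame \<open>k\<close>, the value of
  \<open>d k \<omega>\<close> is irrelevant.
\<close>

definition transmits :: "nat \<Rightarrow> (int \<Rightarrow> 'a \<Rightarrow> bool) \<Rightarrow> nat \<Rightarrow> 'a \<Rightarrow> bool" where
  "transmits m a k \<omega> \<longleftrightarrow> (\<exists>s \<in> generation_slots m k. a s \<omega>)"

definition sent_stamp :: "nat \<Rightarrow> (int \<Rightarrow> 'a \<Rightarrow> bool) \<Rightarrow> nat \<Rightarrow> 'a \<Rightarrow> int" where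
  "sent_stamp m a k \<omega> = Max {s \<in> generation_slots m k. a s \<omega>}"

definition delivered :: "nat \<Rightarrow> (int \<Rightarrow> 'a \<Rightarrow> bool) \<Rightarrow> (nat \<Rightarrow> 'a \<Rightarrow> bool) \<Rightarrow> nat \<Rightarrow> 'a \<Rightarrow> bool" where
  "delivered m a d k \<omega> \<longleftrightarrow> transmits m a k \<omega> \<and> d k \<omega>"

text \<open>
  \<open>stamp_at_frame \<dots> k\<close> is the time-stamp of the last update received by time \<open>k m\<close>, including one
  received exactly at that time; \<open>f\<close> is the time-stamp of the update received at time 0.
\<close>

primrec stamp_at_frame ::
  "nat \<Rightarrow> (int \<Rightarrow> 'a \<Rightarrow> bool) \<Rightarrow> (nat \<Rightarrow> 'a \<Rightarrow> bool) \<Rightarrow> ('a \<Rightarrow> int) \<Rightarrow> nat \<Rightarrow> 'a \<Rightarrow> int" where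
  "stamp_at_frame m a d f 0 \<omega> = f \<omega>"
| "stamp_at_frame m a d f (Suc k) \<omega> =
     (if delivered m a d k \<omega> then sent_stamp m a k \<omega> else stamp_at_frame m a d f k \<omega>)"

definition last_stamp ::
  "nat \<Rightarrow> (int \<Rightarrow> 'a \<Rightarrow> bool) \<Rightarrow> (nat \<Rightarrow> 'a \<Rightarrow> bool) \<Rightarrow> ('a \<Rightarrow> int) \<Rightarrow> real \<Rightarrow> 'a \<Rightarrow> int" where
  "last_stamp m a d f t \<omega> = stamp_at_frame m a d f (nat \<lfloor>t / real m\<rfloor>) \<omega>"

definition age ::
  "nat \<Rightarrow> (int \<Rightarrow> 'a \<Rightarrow> bool) \<Rightarrow> (nat \<Rightarrow> 'a \<Rightarrow> bool) \<Rightarrow> ('a \<Rightarrow> int) \<Rightarrow> real \<Rightarrow> 'a \<Rightarrow> real" where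
  "age m a d f t \<omega> = t - real_of_int (last_stamp m a d f t \<omega>)"

text \<open>The age at the end of frame \<open>k\<close>, just before a possible refresh.\<close>

definition age_before_refresh ::
  "nat \<Rightarrow> (int \<Rightarrow> 'a \<Rightarrow> bool) \<Rightarrow> (nat \<Rightarrow> 'a \<Rightarrow> bool) \<Rightarrow> ('a \<Rightarrow> int) \<Rightarrow> nat \<Rightarrow> 'a \<Rightarrow> real" where
  "age_before_refresh m a d f k \<omega> = age m a d f (real (k * m)) \<omega> + real m"

text \<open>The random inputs of one node, as a single integer-valued family.\<close>

datatype source = Activation int | Decoding nat | First_Stamp

primrec source_value ::
  "(int \<Rightarrow> 'a \<Rightarrow> bool) \<Rightarrow> (nat \<Rightarrow> 'a \<Rightarrow> bool) \<Rightarrow> ('a \<Rightarrow> int) \<Rightarrow> source \<Rightarrow> 'a \<Rightarrow> int" where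
  "source_value a d f (Activation s) = (\<lambda>\<omega>. of_bool (a s \<omega>))"
| "source_value a d f (Decoding k) = (\<lambda>\<omega>. of_bool (d k \<omega>))"
| "source_value a d f First_Stamp = f"

text \<open>
  \<open>n\<close> nodes, of which \<open>u\<close> is the one whose age is tracked; time 0 is the reception time of its first
  update. Whether an update of \<open>u\<close> is decoded depends on the other nodes and on the choice of
  replicas, not on the activity of \<open>u\<close> itself, hence the independence of the inputs of \<open>u\<close>. Nothing
  is assumed on the joint law of the decoding events of different nodes, which may collide.
\<close>

locale irsa = prob_space M for M :: "'a measure" +
  fixes n m :: nat and \<rho> Pl :: real
    and active :: "nat \<Rightarrow> int \<Rightarrow> 'a \<Rightarrow> bool"
    and decoded :: "nat \<Rightarrow> nat \<Rightarrow> 'a \<Rightarrow> bool"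
    and u :: nat and first_stamp :: "'a \<Rightarrow> int"
  assumes n_pos: "n \<ge> 1" and m_pos: "m \<ge> 1"
    and rho_pos: "0 < \<rho>" and rho_less_1: "\<rho> < 1"
    and Pl_nonneg: "0 \<le> Pl" and Pl_less_1: "Pl < 1"
    and node: "u < n"
    and active_prob:
      "\<And>v s. v < n \<Longrightarrow> s \<ge> - int m \<Longrightarrow> \<P>(\<omega> in M. active v s \<omega>) = \<rho>"
    and active_indep:
      "indep_vars (\<lambda>_. count_space UNIV) (\<lambda>(v, s). active v s) ({..<n} \<times> {- int m..})"
    and decoded_prob:
      "\<And>v k. v < n \<Longrightarrow> \<P>(\<omega> in M. decoded v k \<omega>) = 1 - Pl"
    and first_stamp_range:
      "\<And>\<omega>. \<omega> \<in> space M \<Longrightarrow> first_stamp \<omega> \<in> {- 2 * int m ..< - int m}"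
    and node_indep:
      "indep_vars (\<lambda>_. count_space UNIV)
         (source_value (active u) (decoded u) first_stamp)
         (Activation ` {- int m..} \<union> range Decoding \<union> {First_Stamp})"

definition channel_load :: "nat \<Rightarrow> nat \<Rightarrow> real \<Rightarrow> real" where
  "channel_load n m \<rho> = real n * (1 - (1 - \<rho>) ^ m) / real m"

definition throughput :: "nat \<Rightarrow> nat \<Rightarrow> real \<Rightarrow> real \<Rightarrow> real" where
  "throughput n m \<rho> Pl = channel_load n m \<rho> * (1 - Pl)"

definition delivery_prob :: "nat \<Rightarrow> real \<Rightarrow> real \<Rightarrow> real" where
  "delivery_prob m \<rho> Pl = (1 - (1 - \<rho>) ^ m) * (1 - Pl)"

definition p_B :: "nat \<Rightarrow> real \<Rightarrow> nat \<Rightarrow> real" where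
  "p_B m \<rho> b = \<rho> * (1 - \<rho>) ^ (b - 1) / (1 - (1 - \<rho>) ^ m)"

text \<open>The one-step transition probabilities of \<open>\<Omega>\<^sub>k = age (k m) - (m + 1)\<close>.\<close>

definition trans_prob :: "nat \<Rightarrow> real \<Rightarrow> real \<Rightarrow> nat \<Rightarrow> nat \<Rightarrow> real" where
  "trans_prob m \<rho> Pl i j =
     (if j < m then delivery_prob m \<rho> Pl * p_B m \<rho> (j + 1)
      else if j = i + m then 1 - delivery_prob m \<rho> Pl
      else 0)"

definition stationary :: "nat \<Rightarrow> real \<Rightarrow> real \<Rightarrow> nat pmf \<Rightarrow> bool" where
  "stationary m \<rho> Pl \<pi> \<longleftrightarrow>
     (\<forall>j. ((\<lambda>i. pmf \<pi> i * trans_prob m \<rho> Pl i j) has_sum pmf \<pi> j) UNIV)"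

text \<open>
  For \<open>\<theta> > 2 m\<close> the argument of \<open>alpha\<close> and \<open>beta\<close> is \<open>x = \<theta> - 2 m - 1\<close>, the threshold in \<open>P(\<Omega> > x)\<close>.
  The source prints the subscript \<open>\<theta> - 2 m\<close>, which is off by one: for \<open>m = 1\<close> and
  \<open>\<theta> = 3\<close> the age before refresh exceeds 3 unless the previous frame delivered an update, so the
  limit is \<open>1 - \<xi>\<close> for \<open>\<xi> = delivery_prob m \<rho> Pl\<close>, whereas \<open>\<theta> - 2 m = 1\<close> as the argument would give \<open>(1 - \<xi>)^2\<close>.
\<close>

definition alpha :: "nat \<Rightarrow> nat \<Rightarrow> nat" where "alpha m x = x mod m"

definition beta :: "nat \<Rightarrow> nat \<Rightarrow> nat" where "beta m x = x div m"

definition violation_formula :: "nat \<Rightarrow> nat \<Rightarrow> real \<Rightarrow> real \<Rightarrow> int \<Rightarrow> real" where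
  "violation_formula n m \<rho> S \<theta> =
     (if \<theta> > 2 * int m then
        let x = nat (\<theta> - 2 * int m - 1) in
        real m * S / real n * (1 - real m * S / real n) ^ beta m x
          * (((1 - \<rho>) ^ (1 + alpha m x) - (1 - \<rho>) ^ m) / (1 - (1 - \<rho>) ^ m))
        + (1 - real m * S / real n) ^ (1 + beta m x)
      else 1)"

end

theory Submission
  imports Defs
begin

text \<open>
  Delivered time-stamps increase from frame to frame, so the last one received by time \<open>k m\<close> is
  smaller than \<open>T\<close> iff no frame before \<open>k\<close> delivers a stamp \<open>\<ge> T\<close>. The frames are independent, and
  frame \<open>j\<close> delivers such a stamp with probability \<open>(1 - Pl) (1 - (1 - \<rho>)\<^sup>c)\<close>, where \<open>c\<close> counts the
  generation slots of frame \<open>j\<close> that are \<open>\<ge> T\<close>. For \<open>T = k m - m - y\<close> one has \<open>c = m\<close> in the last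
  \<open>y div m\<close> frames, \<open>c = y mod m\<close> in the one before them, and \<open>c = 0\<close> earlier. The
  violation probability is therefore constant as soon as \<open>k > y div m\<close>. The same tail solves the
  balance equations, which determine the stationary law recursively.
\<close>

text \<open>Stands for P(\<Omega> \<ge> y). The second factor is the probability that a frame
  delivers no update from the last \<open>y mod m\<close> of its generation slots.\<close>

definition age_tail :: "nat \<Rightarrow> real \<Rightarrow> real \<Rightarrow> nat \<Rightarrow> real" where
  "age_tail m \<rho> Pl y =
     (1 - delivery_prob m \<rho> Pl) ^ (y div m) * (1 - (1 - Pl) * (1 - (1 - \<rho>) ^ (y mod m)))"

section \<open>Total mass and tails of probability mass functions\<close>

lemma pmf_has_sum_1: "(pmf p has_sum 1) UNIV"
proof -
  have abs: "Infinite_Set_Sum.abs_summable_on (pmf p) UNIV"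
    by (rule pmf_abs_summable)
  then have "infsum (pmf p) UNIV = 1"
    using infsetsum_pmf_eq_1[of p UNIV] infsetsum_infsum[OF abs] by simp
  moreover have "pmf p summable_on UNIV"
    using abs by (metis abs_summable_equivalent abs_summable_summable)
  ultimately show ?thesis
    by (simp add: has_sum_iff)
qed

lemma measure_pmf_atLeast_nat:
  fixes \<pi> :: "nat pmf"
  shows "measure_pmf.prob \<pi> {y..} = 1 - (\<Sum>i<y. pmf \<pi> i)"
proof -
  have "measure_pmf.prob \<pi> {y..} = 1 - measure_pmf.prob \<pi> {..<y}"
    by (subst measure_pmf.prob_compl[symmetric]) (auto intro: arg_cong[where f = "measure_pmf.prob \<pi>"])
  then show ?thesis
    by (simp add: measure_measure_pmf_finite)
qed

section \<open>The tail function and the stationary law\<close>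

context
  fixes m :: nat and \<rho> Pl :: real
  assumes m_pos: "m \<ge> 1" and rho: "0 < \<rho>" "\<rho> < 1" and Pl: "0 \<le> Pl" "Pl < 1"
begin

lemma delivery_prob_bounds: "0 < delivery_prob m \<rho> Pl" "delivery_prob m \<rho> Pl < 1"
proof -
  have "0 < (1 - \<rho>) ^ m" "(1 - \<rho>) ^ m < 1"
    using rho m_pos by (auto simp: power_less_one_iff)
  then have "0 < 1 - (1 - \<rho>) ^ m" "1 - (1 - \<rho>) ^ m < 1"
    by auto
  then show "0 < delivery_prob m \<rho> Pl" "delivery_prob m \<rho> Pl < 1"
    unfolding delivery_prob_def using Pl
    by (auto intro: le_less_trans[OF mult_left_le])
qed

lemma age_tail_add: "age_tail m \<rho> Pl (y + m) = (1 - delivery_prob m \<rho> Pl) * age_tail m \<rho> Pl y"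
  using m_pos by (simp add: age_tail_def)

text \<open>At \<open>y = m\<close> quotient 1 and remainder 0 give
  \<open>1 - delivery_prob m \<rho> Pl\<close>, which is the same value. Including this boundary
  lets differences at \<open>j < m\<close> be computed without a case split.\<close>

lemma age_tail_le:
  assumes "y \<le> m"
  shows "age_tail m \<rho> Pl y = 1 - (1 - Pl) * (1 - (1 - \<rho>) ^ y)"
  using assms m_pos by (cases "y = m") (auto simp: age_tail_def delivery_prob_def mult.commute)

text \<open>Makes the differences of the tail usable as point masses. Below \<open>m\<close> the
  powers of \<open>1 - \<rho>\<close> decrease; beyond, a shift by \<open>m\<close> only rescales
  both sides by a nonnegative factor.\<close>

lemma age_tail_Suc_le: "age_tail m \<rho> Pl (Suc y) \<le> age_tail m \<rho> Pl y"
proof (induction y rule: less_induct)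
  case (less y)
  show ?case
  proof (cases "y < m")
    case True
    have "(1 - \<rho>) ^ Suc y \<le> (1 - \<rho>) ^ y"
      using rho by (intro power_decreasing) auto
    then have "(1 - Pl) * (1 - (1 - \<rho>) ^ y) \<le> (1 - Pl) * (1 - (1 - \<rho>) ^ Suc y)"
      using Pl by (intro mult_left_mono) auto
    then show ?thesis
      using True by (simp add: age_tail_le)
  next
    case False
    then obtain z where z: "y = z + m"
      by (metis add.commute le_Suc_ex not_less)
    then show ?thesis
      using less.IH[of z] age_tail_add[of z] age_tail_add[of "Suc z"] m_pos delivery_prob_bounds
      by (simp add: mult_left_mono)
  qed
qed

lemma age_tail_tendsto_0: "age_tail m \<rho> Pl \<longlonglongrightarrow> 0"
proof -
  let ?\<xi> = "delivery_prob m \<rho> Pl"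
  have bounds: "0 \<le> age_tail m \<rho> Pl y \<and> age_tail m \<rho> Pl y \<le> (1 - ?\<xi>) ^ (y div m)" for y
  proof -
    have "0 \<le> (1 - Pl) * (1 - (1 - \<rho>) ^ (y mod m))" "(1 - Pl) * (1 - (1 - \<rho>) ^ (y mod m)) \<le> 1"
      using rho Pl by (auto intro!: mult_nonneg_nonneg mult_le_one power_le_one)
    then show ?thesis
      using delivery_prob_bounds unfolding age_tail_def
      by (auto intro!: mult_nonneg_nonneg mult_left_le)
  qed
  have lim: "(\<lambda>y. (1 - ?\<xi>) ^ (y div m)) \<longlonglongrightarrow> 0"
  proof (rule filterlim_compose[where f = "\<lambda>y. y div m"])
    show "(\<lambda>y. (1 - ?\<xi>) ^ y) \<longlonglongrightarrow> 0"
      using delivery_prob_bounds by (intro LIMSEQ_realpow_zero) auto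
    show "filterlim (\<lambda>y. y div m) at_top at_top"
      using m_pos by (intro filterlim_at_top_div_const_nat) auto
  qed
  show ?thesis
    by (rule tendsto_sandwich[OF _ _ tendsto_const lim]) (simp_all add: bounds)
qed

text \<open>A state \<open>j < m\<close> is entered with the same probability from every
  \<open>i\<close>, so the balance sum is that constant times the total mass 1. A state
  \<open>j \<ge> m\<close> is entered from \<open>j - m\<close> only.\<close>

lemma stationary_iff_recurrence:
  "stationary m \<rho> Pl \<pi> \<longleftrightarrow>
     (\<forall>j. pmf \<pi> j = (if j < m then delivery_prob m \<rho> Pl * p_B m \<rho> (j + 1)
                    else (1 - delivery_prob m \<rho> Pl) * pmf \<pi> (j - m)))"
proof -
  have "((\<lambda>i. pmf \<pi> i * trans_prob m \<rho> Pl i j) has_sum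
           (if j < m then delivery_prob m \<rho> Pl * p_B m \<rho> (j + 1)
            else (1 - delivery_prob m \<rho> Pl) * pmf \<pi> (j - m))) UNIV" (is "(?f j has_sum _) _") for j
  proof (cases "j < m")
    case True
    then show ?thesis
      using has_sum_cmult_left[OF pmf_has_sum_1[of \<pi>], of "delivery_prob m \<rho> Pl * p_B m \<rho> (j + 1)"]
      by (simp add: trans_prob_def)
  next
    case False
    then show ?thesis
      by (intro has_sum_finite_neutralI[of "{j - m}"]) (auto simp: trans_prob_def)
  qed
  then have "(?f j has_sum c) UNIV \<longleftrightarrow>
      c = (if j < m then delivery_prob m \<rho> Pl * p_B m \<rho> (j + 1)
           else (1 - delivery_prob m \<rho> Pl) * pmf \<pi> (j - m))" for j c
    using has_sum_unique by blast
  then show ?thesis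
    unfolding stationary_def by simp
qed

text \<open>The recurrence expresses each mass outright or through the one at
  \<open>j - m < j\<close>, so it has a single solution; the differences of \<open>age_tail\<close>
  satisfy it.\<close>

lemma stationary_iff:
  "stationary m \<rho> Pl \<pi> \<longleftrightarrow> (\<forall>j. pmf \<pi> j = age_tail m \<rho> Pl j - age_tail m \<rho> Pl (Suc j))"
proof -
  define w where "w j = age_tail m \<rho> Pl j - age_tail m \<rho> Pl (Suc j)" for j
  have "(1 - \<rho>) ^ m < 1"
    using rho m_pos by (auto simp: power_less_one_iff)
  \<comment> \<open>Both sides are (1 - Pl) \<rho> (1 - \<rho>)^j: the normalisation of
    \<open>p_B\<close>, nonzero by the preceding fact, cancels against the factor in
    \<open>delivery_prob\<close>.\<close>
  then have w_less: "w j = delivery_prob m \<rho> Pl * p_B m \<rho> (j + 1)" if "j < m" for j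
    using that by (simp add: w_def age_tail_le delivery_prob_def p_B_def) (simp add: algebra_simps)
  have w_ge: "w j = (1 - delivery_prob m \<rho> Pl) * w (j - m)" if "\<not> j < m" for j
    using that age_tail_add[of "j - m"] age_tail_add[of "Suc (j - m)"]
    by (simp add: w_def algebra_simps)
  have "pmf \<pi> j = w j" if "stationary m \<rho> Pl \<pi>" for j
  proof (induction j rule: less_induct)
    case (less j)
    then show ?case
      using that m_pos w_less[of j] w_ge[of j] unfolding stationary_iff_recurrence by auto
  qed
  moreover have "stationary m \<rho> Pl \<pi>" if "\<forall>j. pmf \<pi> j = w j"
    using that w_less w_ge unfolding stationary_iff_recurrence by auto
  ultimately show ?thesis
    unfolding w_def by blast
qed

lemma ex1_stationary: "\<exists>!\<pi>. stationary m \<rho> Pl \<pi>"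
proof -
  let ?w = "\<lambda>j. age_tail m \<rho> Pl j - age_tail m \<rho> Pl (Suc j)"
  have nonneg: "?w j \<ge> 0" for j
    using age_tail_Suc_le[of j] by simp
  \<comment> \<open>The series telescopes to \<open>age_tail m \<rho> Pl 0 = 1\<close> minus the
    limit 0.\<close>
  have "?w sums 1"
    using telescope_sums'[OF age_tail_tendsto_0] by (simp add: age_tail_le)
  then have "(\<integral>\<^sup>+j. ennreal (?w j) \<partial>count_space UNIV) = 1"
    by (simp add: nn_integral_count_space_nat suminf_ennreal_eq[OF nonneg])
  then have "pmf (embed_pmf ?w) j = ?w j" for j
    using nonneg by (intro pmf_embed_pmf)
  then show ?thesis
    unfolding stationary_iff by (intro ex1I[of _ "embed_pmf ?w"] pmf_eqI) simp_all
qed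

lemma stationary_prob_atLeast:
  assumes "stationary m \<rho> Pl \<pi>"
  shows "measure_pmf.prob \<pi> {y..} = age_tail m \<rho> Pl y"
proof -
  have "(\<Sum>i<y. pmf \<pi> i) = 1 - age_tail m \<rho> Pl y"
    using assms sum_lessThan_telescope'[of "age_tail m \<rho> Pl" y]
    by (simp add: stationary_iff age_tail_le)
  then show ?thesis
    by (simp add: measure_pmf_atLeast_nat)
qed

section \<open>Closed form of the violation probability\<close>

lemma violation_formula_eq_age_tail:
  assumes "n \<ge> 1"
  shows "violation_formula n m \<rho> (throughput n m \<rho> Pl) \<theta> = age_tail m \<rho> Pl (nat (\<theta> - 2 * int m))"
proof (cases "\<theta> > 2 * int m")
  case True
  define x where "x = nat (\<theta> - 2 * int m - 1)"
  define r where "r = x mod m"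
  define \<xi> where "\<xi> = delivery_prob m \<rho> Pl"
  have Suc_x: "nat (\<theta> - 2 * int m) = Suc x"
    using True by (simp add: x_def)
  have \<xi>: "real m * throughput n m \<rho> Pl / real n = \<xi>"
    using assms m_pos by (simp add: throughput_def channel_load_def delivery_prob_def \<xi>_def)
  have "(1 - \<rho>) ^ m < 1"
    using rho m_pos by (auto simp: power_less_one_iff)
  then have "\<xi> * (((1 - \<rho>) ^ Suc r - (1 - \<rho>) ^ m) / (1 - (1 - \<rho>) ^ m))
      = (1 - Pl) * ((1 - \<rho>) ^ Suc r - (1 - \<rho>) ^ m)"
    by (simp add: \<xi>_def delivery_prob_def)
  then have step: "\<xi> * (((1 - \<rho>) ^ Suc r - (1 - \<rho>) ^ m) / (1 - (1 - \<rho>) ^ m)) + (1 - \<xi>)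
      = age_tail m \<rho> Pl (Suc r)"
    using m_pos by (simp add: age_tail_le Suc_leI r_def \<xi>_def delivery_prob_def algebra_simps)
  \<comment> \<open>Whole frames are split off explicitly because \<open>Suc r\<close> may equal
    \<open>m\<close>; then \<open>Suc x div m\<close> differs from \<open>x div m\<close> and the
    definition cannot be matched term by term.\<close>
  have shift: "age_tail m \<rho> Pl (z + q * m) = (1 - \<xi>) ^ q * age_tail m \<rho> Pl z" for z q
    using m_pos by (simp add: age_tail_def power_add \<xi>_def)
  have "violation_formula n m \<rho> (throughput n m \<rho> Pl) \<theta> =
      \<xi> * (1 - \<xi>) ^ (x div m) * (((1 - \<rho>) ^ Suc r - (1 - \<rho>) ^ m) / (1 - (1 - \<rho>) ^ m))
        + (1 - \<xi>) ^ Suc (x div m)"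
    using True by (simp add: violation_formula_def Let_def \<xi> x_def[symmetric] alpha_def beta_def r_def)
  also have "\<dots> = (1 - \<xi>) ^ (x div m)
      * (\<xi> * (((1 - \<rho>) ^ Suc r - (1 - \<rho>) ^ m) / (1 - (1 - \<rho>) ^ m)) + (1 - \<xi>))"
    by (simp only: power_Suc distrib_left mult_ac)
  also have "\<dots> = age_tail m \<rho> Pl (Suc r + x div m * m)"
    by (simp only: step shift)
  also have "Suc r + x div m * m = Suc x"
    by (simp add: r_def)
  finally show ?thesis
    by (simp add: Suc_x)
next
  case False
  then show ?thesis
    by (simp add: violation_formula_def age_tail_le)
qed

end

section \<open>Time-stamps along a sample path\<close>

lemma finite_generation_slots [simp]: "finite (generation_slots m k)"
  by (simp add: generation_slots_def)

lemma sent_stamp_less_iff: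
  assumes "transmits m a k \<omega>"
  shows "sent_stamp m a k \<omega> < T \<longleftrightarrow> \<not> (\<exists>s \<in> generation_slots m k \<inter> {T..}. a s \<omega>)"
proof -
  have "sent_stamp m a k \<omega> < T \<longleftrightarrow> (\<forall>s \<in> {s \<in> generation_slots m k. a s \<omega>}. s < T)"
    unfolding sent_stamp_def
    using assms by (subst Max_less_iff) (auto simp: transmits_def)
  then show ?thesis
    by (auto simp: not_le)
qed

text \<open>What has been received by time \<open>k * m\<close> is older than every slot whose
  update can be sent over frame \<open>k\<close>. Hence a delivery always raises the stamp.\<close>

lemma stamp_at_frame_bound:
  assumes "f \<omega> < - int m"
  shows "stamp_at_frame m a d f k \<omega> < int k * int m - int m"
proof (induction k)
  case 0
  then show ?case using assms by simp
next
  case (Suc k)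
  have "sent_stamp m a k \<omega> < int k * int m" if "delivered m a d k \<omega>"
    using that by (subst sent_stamp_less_iff) (auto simp: delivered_def generation_slots_def)
  with Suc show ?case
    by (auto simp: algebra_simps)
qed

text \<open>Turns the recursion into one condition per frame, each on the inputs of that frame
  alone, which is the form independence needs. \<open>delivered\<close> disappears because an active
  slot among those \<open>\<ge> T\<close> already implies a transmission.\<close>

lemma stamp_at_frame_less_iff:
  assumes "f \<omega> < - int m"
  shows "stamp_at_frame m a d f k \<omega> < T \<longleftrightarrow>
    f \<omega> < T \<and> (\<forall>j<k. \<not> (d j \<omega> \<and> (\<exists>s \<in> generation_slots m j \<inter> {T..}. a s \<omega>)))"
proof (induction k)
  case 0
  then show ?case by simp
next
  case (Suc k)
  let ?E = "\<exists>s \<in> generation_slots m k \<inter> {T..}. a s \<omega>"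
  have *: "stamp_at_frame m a d f (Suc k) \<omega> < T \<longleftrightarrow>
    stamp_at_frame m a d f k \<omega> < T \<and> \<not> (d k \<omega> \<and> ?E)"
  proof (cases "delivered m a d k \<omega>")
    case True
    then have "transmits m a k \<omega>" "d k \<omega>"
      by (auto simp: delivered_def)
    \<comment> \<open>Some slot of the frame is active and, without \<open>?E\<close>, lies below
      \<open>T\<close>. So \<open>T\<close> is beyond the start of the generation slots, which
      exceeds all earlier stamps, and the conjunct on the past holds by itself.\<close>
    moreover have "stamp_at_frame m a d f k \<omega> < T" if "\<not> ?E"
    proof -
      obtain s where "s \<in> generation_slots m k" "a s \<omega>"
        using \<open>transmits m a k \<omega>\<close> by (auto simp: transmits_def)
      then have "int k * int m - int m < T"
        using that by (force simp: generation_slots_def)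
      then show ?thesis
        using stamp_at_frame_bound[of f \<omega> m a d k] assms by simp
    qed
    ultimately show ?thesis
      using True by (auto simp: sent_stamp_less_iff)
  next
    case False
    then show ?thesis
      by (auto simp: delivered_def transmits_def)
  qed
  show ?case
    unfolding * Suc.IH by (auto simp: less_Suc_eq)
qed

lemma age_before_refresh_greater_iff:
  assumes "m \<ge> 1" and "f \<omega> < - int m"
  shows "age_before_refresh m a d f k \<omega> > real_of_int \<theta> \<longleftrightarrow>
    stamp_at_frame m a d f k \<omega> < int k * int m - int m - int (nat (\<theta> - 2 * int m))"
proof -
  have "age_before_refresh m a d f k \<omega> = real_of_int (int k * int m + int m - stamp_at_frame m a d f k \<omega>)"
    using assms(1) by (simp add: age_before_refresh_def age_def last_stamp_def)
  then have "age_before_refresh m a d f k \<omega> > real_of_int \<theta> \<longleftrightarrow>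
      stamp_at_frame m a d f k \<omega> < int k * int m + int m - \<theta>"
    by (simp only: of_int_less_iff) linarith
  \<comment> \<open>For \<open>\<theta> < 2 * int m\<close> the truncation by \<open>nat\<close>
    changes the threshold, but the bound on stamps makes both sides true.\<close>
  then show ?thesis
    using stamp_at_frame_bound[of f \<omega> m a d k] assms(2) by (cases "\<theta> \<ge> 2 * int m") auto
qed

lemma generation_slots_disjoint:
  assumes "i \<noteq> j"
  shows "generation_slots m i \<inter> generation_slots m j = {}"
proof -
  have *: "generation_slots m i \<inter> generation_slots m j = {}" if "i < j" for i j
  proof -
    have "int i * int m \<le> (int j - 1) * int m"
      using that by (intro mult_right_mono) auto
    then show ?thesis
      by (auto simp: generation_slots_def algebra_simps)
  qed
  show ?thesis
    using assms *[of i j] *[of j i] by (cases "i < j") auto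
qed

section \<open>Probabilities of deliveries and of age violations\<close>

context irsa
begin

abbreviation "input \<equiv> source_value (active u) (decoded u) first_stamp"
abbreviation "inputs \<equiv> Activation ` {- int m..} \<union> range Decoding \<union> {First_Stamp}"

lemma input_measurable: "i \<in> inputs \<Longrightarrow> input i \<in> M \<rightarrow>\<^sub>M count_space UNIV"
  using node_indep by (auto simp: indep_vars_def)

lemma decoded_measurable [measurable]: "Measurable.pred M (decoded u k)"
proof -
  have "Measurable.pred M (\<lambda>\<omega>. input (Decoding k) \<omega> = 1)"
    by (intro pred_count_space_const1 input_measurable) auto
  then show ?thesis by simp
qed

lemma active_measurable:
  assumes "s \<ge> - int m"
  shows "Measurable.pred M (active u s)"
proof -
  have "Measurable.pred M (\<lambda>\<omega>. input (Activation s) \<omega> = 1)"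
    using assms by (intro pred_count_space_const1 input_measurable) auto
  then show ?thesis by simp
qed

lemma generation_slots_ge: "s \<in> generation_slots m j \<Longrightarrow> s \<ge> - int m"
  by (auto simp: generation_slots_def) (smt (verit) mult_nonneg_nonneg of_nat_0_le_iff)

lemma prob_decoded_inactive:
  assumes "finite S" "S \<subseteq> {- int m..}"
  shows "\<P>(\<omega> in M. decoded u k \<omega> \<and> (\<forall>s\<in>S. \<not> active u s \<omega>)) = (1 - Pl) * (1 - \<rho>) ^ card S"
proof -
  let ?J = "insert (Decoding k) (Activation ` S)"
  \<comment> \<open>Activations are required to be 0 and the decoding to be 1; the set for
    \<open>First_Stamp\<close> is a dummy, as that source is not in \<open>?J\<close>.\<close>
  let ?A = "case_source (\<lambda>_. {0}) (\<lambda>_. {1}) {} :: source \<Rightarrow> int set"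
  let ?P = "\<lambda>i. prob (input i -` ?A i \<inter> space M)"
  have inact: "?P (Activation s) = 1 - \<rho>" if "s \<in> S" for s
  proof -
    have s: "s \<ge> - int m" using that assms by auto
    have "?P (Activation s) = \<P>(\<omega> in M. \<not> active u s \<omega>)"
      by (intro arg_cong[where f = prob]) auto
    also have "\<dots> = 1 - \<P>(\<omega> in M. active u s \<omega>)"
      using active_measurable[OF s] by (intro prob_neg) measurable
    finally show ?thesis
      using active_prob[OF node s] by simp
  qed
  have dec: "?P (Decoding k) = 1 - Pl"
    using decoded_prob[OF node, of k]
    by (auto simp: vimage_def Int_def conj_commute)
  have "\<P>(\<omega> in M. decoded u k \<omega> \<and> (\<forall>s\<in>S. \<not> active u s \<omega>))
      = prob (\<Inter>i\<in>?J. input i -` ?A i \<inter> space M)"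
    by (intro arg_cong[where f = prob]) auto
  also have "\<dots> = (\<Prod>i\<in>?J. ?P i)"
    using assms by (intro indep_varsD[OF node_indep]) auto
  also have "\<dots> = ?P (Decoding k) * (\<Prod>s\<in>S. ?P (Activation s))"
    using assms(1) by (subst prod.insert) (auto simp: prod.reindex inj_on_def)
  also have "\<dots> = (1 - Pl) * (1 - \<rho>) ^ card S"
    using inact dec by simp
  finally show ?thesis .
qed

text \<open>Activity in \<open>S\<close> is a union over slots and does not factorise directly, so
  its joint probability with decoding is obtained by subtracting the case of complete
  inactivity.\<close>

lemma prob_no_decoded_active:
  assumes "finite S" "S \<subseteq> {- int m..}"
  shows "\<P>(\<omega> in M. \<not> (decoded u k \<omega> \<and> (\<exists>s\<in>S. active u s \<omega>))) = 1 - (1 - Pl) * (1 - (1 - \<rho>) ^ card S)"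
proof -
  define E where "E \<omega> \<longleftrightarrow> (\<exists>s\<in>S. active u s \<omega>)" for \<omega>
  have [measurable]: "Measurable.pred M E"
    unfolding E_def using assms by (intro pred_intros_finite active_measurable) auto
  have "\<P>(\<omega> in M. decoded u k \<omega>) =
      \<P>(\<omega> in M. decoded u k \<omega> \<and> E \<omega>) + \<P>(\<omega> in M. decoded u k \<omega> \<and> \<not> E \<omega>)"
    by (subst finite_measure_Union[symmetric]) (auto intro!: arg_cong[where f = prob])
  moreover have "\<P>(\<omega> in M. decoded u k \<omega> \<and> \<not> E \<omega>) = (1 - Pl) * (1 - \<rho>) ^ card S"
    using prob_decoded_inactive[OF assms, of k] by (simp add: E_def)
  moreover have "\<P>(\<omega> in M. \<not> (decoded u k \<omega> \<and> E \<omega>)) = 1 - \<P>(\<omega> in M. decoded u k \<omega> \<and> E \<omega>)"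
    by (intro prob_neg) measurable
  ultimately have "\<P>(\<omega> in M. \<not> (decoded u k \<omega> \<and> E \<omega>)) = 1 - (1 - Pl) * (1 - (1 - \<rho>) ^ card S)"
    using decoded_prob[OF node, of k] by (simp add: algebra_simps)
  then show ?thesis
    by (simp only: E_def)
qed

text \<open>Each frame reads its own decoding variable and the activations of its own generation
  slots. These blocks of inputs are disjoint, so the events are independent.\<close>

lemma prob_no_decoded_active_frames:
  assumes S: "\<And>j. S j \<subseteq> generation_slots m j"
  shows "\<P>(\<omega> in M. \<forall>j<k. \<not> (decoded u j \<omega> \<and> (\<exists>s\<in>S j. active u s \<omega>))) =
    (\<Prod>j<k. 1 - (1 - Pl) * (1 - (1 - \<rho>) ^ card (S j)))"
\<comment> \<open>Without frames the intersection used below would be the whole type rather than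
  \<open>space M\<close>.\<close>
proof (cases "k = 0")
  case True
  then show ?thesis by (simp add: prob_space)
next
  case False
  have S': "finite (S j)" "S j \<subseteq> {- int m..}" for j
    using S[of j] finite_subset[OF S[of j]] generation_slots_ge by auto
  have S_disjoint: "s \<notin> S j" if "s \<in> S i" "i \<noteq> j" for s i j
    using that S[of i] S[of j] generation_slots_disjoint[of i j m] by blast
  let ?K = "\<lambda>j. insert (Decoding j) (Activation ` S j)"
  \<comment> \<open>The event of frame \<open>j\<close> as a function of its block of inputs;
    comparison with 1 decodes the \<open>of_bool\<close> encoding.\<close>
  let ?Y = "\<lambda>j x. \<not> (x (Decoding j) = (1::int) \<and> (\<exists>s\<in>S j. x (Activation s) = 1))"
  have "indep_vars (\<lambda>j. PiM (?K j) (\<lambda>_. count_space UNIV)) (\<lambda>j \<omega>. \<lambda>i\<in>?K j. input i \<omega>) {..<k}"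
  proof (rule indep_vars_restrict[OF node_indep])
    show "?K j \<subseteq> inputs" for j
      using S'[of j] by auto
    show "disjoint_family_on ?K {..<k}"
      using S_disjoint by (auto simp: disjoint_family_on_def)
  qed
  then have indep: "indep_vars (\<lambda>_. count_space UNIV) (\<lambda>j \<omega>. ?Y j (\<lambda>i\<in>?K j. input i \<omega>)) {..<k}"
  proof (rule indep_vars_compose2)
    fix j
    have comp: "(\<lambda>x. x i) \<in> PiM (?K j) (\<lambda>_. count_space (UNIV :: int set)) \<rightarrow>\<^sub>M count_space UNIV"
      if "i \<in> ?K j" for i
      using that by (rule measurable_component_singleton)
    have "Measurable.pred (PiM (?K j) (\<lambda>_. count_space UNIV)) (\<lambda>x. x i = (1::int))" if "i \<in> ?K j" for i
      using comp[OF that] by measurable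
    then show "?Y j \<in> PiM (?K j) (\<lambda>_. count_space UNIV) \<rightarrow>\<^sub>M count_space UNIV"
      using S'(1)[of j] by (intro pred_intros_logic pred_intros_finite) auto
  qed
  have "\<P>(\<omega> in M. \<forall>j<k. \<not> (decoded u j \<omega> \<and> (\<exists>s\<in>S j. active u s \<omega>))) =
      prob (\<Inter>j\<in>{..<k}. (\<lambda>\<omega>. ?Y j (\<lambda>i\<in>?K j. input i \<omega>)) -` {True} \<inter> space M)"
    using False by (intro arg_cong[where f = prob]) auto
  also have "\<dots> = (\<Prod>j<k. prob ((\<lambda>\<omega>. ?Y j (\<lambda>i\<in>?K j. input i \<omega>)) -` {True} \<inter> space M))"
    using False by (intro indep_varsD_finite[OF indep]) auto
  also have "\<dots> = (\<Prod>j<k. \<P>(\<omega> in M. \<not> (decoded u j \<omega> \<and> (\<exists>s\<in>S j. active u s \<omega>))))"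
    by (intro prod.cong refl arg_cong[where f = prob]) auto
  also have "\<dots> = (\<Prod>j<k. 1 - (1 - Pl) * (1 - (1 - \<rho>) ^ card (S j)))"
    using S' by (intro prod.cong refl prob_no_decoded_active)
  finally show ?thesis .
qed

lemma prob_age_before_refresh:
  assumes k: "nat (\<theta> - 2 * int m) div m < k"
  shows "\<P>(\<omega> in M. age_before_refresh m (active u) (decoded u) first_stamp k \<omega> > real_of_int \<theta>) =
    age_tail m \<rho> Pl (nat (\<theta> - 2 * int m))"
proof -
  define y where "y = nat (\<theta> - 2 * int m)"
  define q where "q = y div m"
  define r where "r = y mod m"
  \<comment> \<open>Frame \<open>l\<close> is the one whose generation slots are cut by
    \<open>T\<close>, leaving the last \<open>r\<close> of them. The bound on \<open>k\<close>
    ensures that the subtraction does not truncate.\<close>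
  define l where "l = k - Suc q"
  define T where "T = int l * int m - int r"
  define S where "S j = generation_slots m j \<inter> {T..}" for j
  have k_eq: "k = l + Suc q"
    using k by (simp add: l_def q_def y_def)
  have y_eq: "int y = int q * int m + int r"
    unfolding q_def r_def by (metis div_mult_mod_eq of_nat_add of_nat_mult)
  have T_eq: "int k * int m - int m - int y = T"
    by (simp add: T_def k_eq y_eq algebra_simps)
  have r_less: "r < m"
    using m_pos by (simp add: r_def)
  \<comment> \<open>Every possible first stamp is then below \<open>T\<close>, so the initial
    condition drops out.\<close>
  have "T \<ge> - int m"
    using r_less unfolding T_def by (smt (verit) mult_nonneg_nonneg of_nat_0_le_iff of_nat_less_iff)
  have card_S: "card (S j) = (if j < l then 0 else if j = l then r else m)" for j
  proof -
    consider "j < l" | "j = l" | "l < j" by linarith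
    then show ?thesis
    proof cases
      case 1
      then have "int j * int m \<le> (int l - 1) * int m"
        by (intro mult_right_mono) auto
      then have "S j = {}"
        using r_less by (auto simp: S_def T_def generation_slots_def algebra_simps)
      with 1 show ?thesis by simp
    next
      case 2
      then have "S j = {T..<int l * int m}"
        using r_less by (auto simp: S_def T_def generation_slots_def)
      with 2 show ?thesis by (simp add: T_def)
    next
      case 3
      then have "(int l + 1) * int m \<le> int j * int m"
        by (intro mult_right_mono) auto
      then have "S j = generation_slots m j"
        by (auto simp: S_def T_def generation_slots_def algebra_simps)
      with 3 show ?thesis by (simp add: generation_slots_def)
    qed
  qed
  have "age_before_refresh m (active u) (decoded u) first_stamp k \<omega> > real_of_int \<theta> \<longleftrightarrow>
      (\<forall>j<k. \<not> (decoded u j \<omega> \<and> (\<exists>s\<in>S j. active u s \<omega>)))" if "\<omega> \<in> space M" for \<omega>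
  proof -
    have "first_stamp \<omega> < - int m"
      using first_stamp_range[OF that] by simp
    then show ?thesis
      using \<open>T \<ge> - int m\<close>
      by (simp add: age_before_refresh_greater_iff[OF m_pos] stamp_at_frame_less_iff
          y_def[symmetric] T_eq S_def)
  qed
  then have "\<P>(\<omega> in M. age_before_refresh m (active u) (decoded u) first_stamp k \<omega> > real_of_int \<theta>) =
      \<P>(\<omega> in M. \<forall>j<k. \<not> (decoded u j \<omega> \<and> (\<exists>s\<in>S j. active u s \<omega>)))"
    by (intro arg_cong[where f = prob]) auto
  also have "\<dots> = (\<Prod>j<k. 1 - (1 - Pl) * (1 - (1 - \<rho>) ^ card (S j)))"
    by (rule prob_no_decoded_active_frames) (simp add: S_def)
  \<comment> \<open>Frames before \<open>l\<close> contribute 1, frame \<open>l\<close> the partial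
    factor, and each of the \<open>q\<close> later ones
    \<open>1 - delivery_prob m \<rho> Pl\<close>; the induction peels off the last frame.\<close>
  also have "\<dots> = (1 - (1 - Pl) * (1 - (1 - \<rho>) ^ r)) * (1 - delivery_prob m \<rho> Pl) ^ q"
    unfolding k_eq by (induction q) (simp_all add: card_S delivery_prob_def mult_ac)
  also have "\<dots> = age_tail m \<rho> Pl y"
    by (simp add: age_tail_def q_def r_def)
  finally show ?thesis
    by (simp only: y_def)
qed

end

theorem proposition3:
  fixes M :: "'a measure" and n m u :: nat and \<rho> Pl :: real and \<theta> :: int
    and active :: "nat \<Rightarrow> int \<Rightarrow> 'a \<Rightarrow> bool"
    and decoded :: "nat \<Rightarrow> nat \<Rightarrow> 'a \<Rightarrow> bool"
    and first_stamp :: "'a \<Rightarrow> int"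
  assumes "irsa M n m \<rho> Pl active decoded u first_stamp"
  shows "(\<exists>!\<pi>. stationary m \<rho> Pl \<pi>) \<and>
    (\<forall>\<pi>. stationary m \<rho> Pl \<pi> \<longrightarrow>
      ((\<lambda>k. \<P>(\<omega> in M. age_before_refresh m (active u) (decoded u) first_stamp k \<omega> > real_of_int \<theta>))
         \<longlonglongrightarrow> measure_pmf.prob \<pi> {x. int x > \<theta> - 2 * int m - 1}) \<and>
      measure_pmf.prob \<pi> {x. int x > \<theta> - 2 * int m - 1} =
        violation_formula n m \<rho> (throughput n m \<rho> Pl) \<theta>)"
proof -
  interpret irsa M n m \<rho> Pl active decoded u first_stamp
    by (rule assms)
  note params = m_pos rho_pos rho_less_1 Pl_nonneg Pl_less_1
  let ?y = "nat (\<theta> - 2 * int m)"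
  \<comment> \<open>The strict bound at \<theta> - 2m - 1 becomes a non-strict one at
    \<open>?y\<close>; for \<theta> \<le> 2m truncation gives \<open>?y = 0\<close>, hence all
    states.\<close>
  have set_eq: "{x. int x > \<theta> - 2 * int m - 1} = {?y..}"
    by auto
  have "(\<lambda>k. \<P>(\<omega> in M. age_before_refresh m (active u) (decoded u) first_stamp k \<omega> > real_of_int \<theta>))
      \<longlonglongrightarrow> age_tail m \<rho> Pl ?y"
    by (rule tendsto_eventually)
      (use prob_age_before_refresh[of \<theta>] in \<open>auto intro: eventually_mono[OF eventually_gt_at_top]\<close>)
  then show ?thesis
    using ex1_stationary[OF params] stationary_prob_atLeast[OF params]
      violation_formula_eq_age_tail[OF params n_pos]
    unfolding set_eq by auto
qed

end
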